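(* A non-complete graph $G$ with order $n\geq 3$ has $\mathrm{gp}(\mathcal{M}(G))=n+\alpha(G)-1$ if and only if $G$ is either a clique $K_{n-1}$ with a leaf attached, or has the following structure: (i) $V(G)=V_{1,1}\cup V_{1,2}\cup V_2\cup\{x\}$; (ii) $V_{1,1}\cup V_{1,2}$ is an independent set; (iii) $x$ is adjacent to every vertex of $V_{1,1}\cup V_{1,2}$, and if $V_{1,1}\neq\emptyset$, then $x$ is a universal vertex; (iv) $(V_{1,2},V_2)$ is a perfect matching; and (v) any vertex of $V_2$ that is not universal in the induced subgraph $\langle V_2\rangle$ is adjacent to $x$.
   Context: All graphs are simple, connected and finite. The order of a graph is its number of vertices. $\alpha(G)$ is the independence number of $G$, i.e. the cardinality of a largest set of mutually non-adjacent vertices (independent set). $K_{n-1}$ is the complete graph on $n-1$ vertices, and a leaf is a vertex of degree one. A set $S$ of vertices of a graph $H$ is a general position set if no shortest path in $H$ contains three or more vertices of $S$; $\mathrm{gp}(H)$ is the number of vertices in a largest general position set of $H$. The Mycielskian $\mathcal{M}(G)$ of a graph $G$ with vertex set $V$ and edge set $E$ has vertex set $V\cup V'\cup\{u^*\}$, where $V'=\{u' : u\in V\}$ is a disjoint copy of $V$ and $u^*$ is an additional vertex (the root), and edge set $E\cup\{uv' : uv\in E\}\cup\{v'u^* : v'\in V'\}$ (for each edge $uv\in E$ both $uv'$ and $vu'$ are included). For $A,B\subseteq V(G)$, $(A,B)$ denotes the set of edges of $G$ from $A$ to $B$; that $(V_{1,2},V_2)$ is a perfect matching means that every vertex of $V_{1,2}$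 has exactly one neighbour in $V_2$ and every vertex of $V_2$ has exactly one neighbour in $V_{1,2}$. $\langle U\rangle$ is the subgraph induced by $U\subseteq V(G)$. A vertex of a graph is universal if it is adjacent to all other vertices of that graph.
   Formalization: The parts V_{1,1}, V_{1,2}, V_2, {x} are taken pairwise disjoint, and it is added that no edge joins V_{1,1} to V_2; without this K_4 minus an edge satisfies (i)–(v) although gp(M(G)) is not n+α(G)-1. *)

theory Defs
  imports "Graph_Theory.Graph_Theory"
begin

text \<open>
  A finite simple graph is a \<^locale>\<open>pair_graph\<close>: every edge is represented by its two
  opposite arcs, so the degree of a vertex is its \<^const>\<open>out_degree\<close>.
\<close>

definition independent_set :: "('a, 'b) pre_digraph \<Rightarrow> 'a set \<Rightarrow> bool" where
  "independent_set G S \<longleftrightarrow> S \<subseteq> verts G \<and> pairwise (\<lambda>u v. \<not> u \<rightarrow>\<^bsub>G\<^esub> v) S"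

definition independence_number :: "('a, 'b) pre_digraph \<Rightarrow> nat" where
  "independence_number G = Max (card ` {S. independent_set G S})"

definition shortest_vpath :: "('a, 'b) pre_digraph \<Rightarrow> 'a vwalk \<Rightarrow> bool" where
  "shortest_vpath G p \<longleftrightarrow> vpath p G \<and>
     (\<forall>q. vpath q G \<and> hd q = hd p \<and> last q = last p \<longrightarrow> vwalk_length p \<le> vwalk_length q)"

definition general_position_set :: "('a, 'b) pre_digraph \<Rightarrow> 'a set \<Rightarrow> bool" where
  "general_position_set G S \<longleftrightarrow>
     S \<subseteq> verts G \<and> \<not> (\<exists>p. shortest_vpath G p \<and> card (set p \<inter> S) \<ge> 3)"

definition gp_number :: "('a, 'b) pre_digraph \<Rightarrow> nat" where
  "gp_number G = Max (card ` {S. general_position_set G S})"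

datatype 'a mycielski_vertex = Orig 'a | Copy 'a | Root

definition mycielskian :: "'a pair_pre_digraph \<Rightarrow> 'a mycielski_vertex pair_pre_digraph" where
  "mycielskian G =
     \<lparr> pverts = Orig ` pverts G \<union> Copy ` pverts G \<union> {Root},
       parcs = {(Orig u, Orig v) |u v. (u, v) \<in> parcs G}
         \<union> {(Orig u, Copy v) |u v. (u, v) \<in> parcs G}
         \<union> {(Copy u, Orig v) |u v. (u, v) \<in> parcs G}
         \<union> {(Copy v, Root) |v. v \<in> pverts G}
         \<union> {(Root, Copy v) |v. v \<in> pverts G} \<rparr>"

lemma pair_graph_mycielskian:
  assumes "pair_graph G"
  shows "pair_graph (mycielskian G)"
proof -
  interpret pair_graph G by fact
  let ?M = "mycielskian G"
  have fin: "finite (pverts ?M)"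
    using pair_finite_verts by (simp add: mycielskian_def)
  have sub: "parcs ?M \<subseteq> pverts ?M \<times> pverts ?M"
    by (auto simp: mycielskian_def dest: in_arcsD1 in_arcsD2)
  have "finite (parcs ?M)"
    using fin sub by (meson finite_SigmaI finite_subset)
  moreover have "symmetric (with_proj ?M)"
    by (auto simp: mycielskian_def symmetric_def sym_def dest: arcs_symmetric)
  moreover have "fst e \<noteq> snd e" if "e \<in> parcs ?M" for e
    using that by (auto simp: mycielskian_def dest: no_loops')
  ultimately show ?thesis
    using fin sub by unfold_locales auto
qed

definition universal_vertex :: "('a, 'b) pre_digraph \<Rightarrow> 'a \<Rightarrow> bool" where
  "universal_vertex G v \<longleftrightarrow> v \<in> verts G \<and> (\<forall>u \<in> verts G - {v}. v \<rightarrow>\<^bsub>G\<^esub> u)"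

definition clique_with_leaf :: "('a, 'b) pre_digraph \<Rightarrow> bool" where
  "clique_with_leaf G \<longleftrightarrow>
     (\<exists>l \<in> verts G. out_degree G l = 1 \<and> K\<^bsub>card (verts G) - 1\<^esub> (G \<restriction> (verts G - {l})))"

definition perfect_matching_between :: "('a, 'b) pre_digraph \<Rightarrow> 'a set \<Rightarrow> 'a set \<Rightarrow> bool" where
  "perfect_matching_between G A B \<longleftrightarrow>
     (\<forall>a \<in> A. \<exists>!b. b \<in> B \<and> a \<rightarrow>\<^bsub>G\<^esub> b) \<and> (\<forall>b \<in> B. \<exists>!a. a \<in> A \<and> b \<rightarrow>\<^bsub>G\<^esub> a)"

text \<open>
  The four parts are pairwise disjoint, and each of \<open>V11\<close>, \<open>V12\<close>, \<open>V2\<close> may be empty.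
  The edges between the independent set \<open>V11 \<union> V12\<close> and \<open>V2\<close> are exactly those of the
  matching, i.e. \<open>V11\<close> is the set of vertices of the independent set without a neighbour
  in \<open>V2\<close>.  Without this the structure would also describe \<open>K\<^sub>4\<close> minus an edge, for which
  the gp-number of the Mycielskian is 4 rather than 5.
\<close>

definition matched_structure ::
    "('a, 'b) pre_digraph \<Rightarrow> 'a set \<Rightarrow> 'a set \<Rightarrow> 'a set \<Rightarrow> 'a \<Rightarrow> bool" where
  "matched_structure G V11 V12 V2 x \<longleftrightarrow>
     verts G = V11 \<union> V12 \<union> V2 \<union> {x} \<and>
     V11 \<inter> V12 = {} \<and> (V11 \<union> V12) \<inter> V2 = {} \<and> x \<notin> V11 \<union> V12 \<union> V2 \<and>
     independent_set G (V11 \<union> V12) \<and>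
     (\<forall>v \<in> V11 \<union> V12. x \<rightarrow>\<^bsub>G\<^esub> v) \<and> (V11 \<noteq> {} \<longrightarrow> universal_vertex G x) \<and>
     perfect_matching_between G V12 V2 \<and>
     (\<forall>u \<in> V11. \<forall>v \<in> V2. \<not> u \<rightarrow>\<^bsub>G\<^esub> v) \<and>
     (\<forall>v \<in> V2. \<not> universal_vertex (G \<restriction> V2) v \<longrightarrow> v \<rightarrow>\<^bsub>G\<^esub> x)"

end

theory Submission
  imports Defs
begin

text \<open>
  Let \<open>n\<close> be the order and \<open>\<alpha> \<ge> 2\<close> the independence number of the non-complete graph \<open>G\<close>.
  Being in general position is a metric condition: no three vertices of the set turn the triangle
  inequality into an equality.  The distances in the Mycielskian are at most 4 and are given by
  walks of length at most 3 in \<open>G\<close>, so everything reduces to finitely many patterns of adjacency.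

  Let \<open>S\<close> be a general position set without the root, let \<open>A\<close> and \<open>B\<close> be the vertices of \<open>G\<close>
  whose originals and copies belong to \<open>S\<close>, and let \<open>C = A \<inter> B\<close>.  Then \<open>|S| = |A \<union> B| + |C|\<close>.
  A neighbour in \<open>A\<close> of a vertex in \<open>C\<close> would lie between that vertex and its copy, so \<open>C\<close> is
  independent and \<open>|S| \<le> n + \<alpha>\<close>.  The decisive point is that two elements of \<open>C\<close>
  force a vertex outside \<open>A \<union> B\<close> (\<open>doubled_share_unused_neighbour\<close>,
  \<open>two_doubled_imp_unused_vertex\<close>).  This improves the bound to \<open>n + \<alpha> - 1\<close> and leaves two ways to
  attain it.  Either \<open>C\<close> is a maximum independent set and exactly one vertex \<open>x\<close> is outside
  \<open>A \<union> B\<close>; excluding collinear triples then yields precisely the matched structure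
  (\<open>matched_structure_of_doubled\<close>).  Or \<open>|C| = 1\<close>, \<open>A \<union> B\<close> contains all vertices and
  \<open>\<alpha> = 2\<close>; then the vertex in \<open>C\<close> is a leaf at a universal vertex, and \<open>\<alpha> = 2\<close> makes the rest a
  clique (\<open>leaf_with_copy_everywhere\<close>).  A set with the root contains at most one copy, and if it
  attains the bound, \<open>G\<close> is again a clique with a leaf (\<open>root_case\<close>).

  Conversely, the bound is attained by all copies together with the leaf in the first kind of graph
  (\<open>gp_set_of_clique_with_leaf\<close>), and in the second kind by the originals of \<open>V11 \<union> V12\<close> together
  with all copies but that of \<open>x\<close> (\<open>gp_set_of_matched_structure\<close>), since \<open>V11 \<union> V12\<close> is then a
  maximum independent set unless \<open>G\<close> is the path on three vertices, which is of the first kind.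
\<close>

section \<open>General position in terms of distances\<close>

text \<open>
  The three axioms characterise the path metric: the second bounds \<open>d\<close> from above along every
  walk, so no walk is shorter than \<open>d\<close>, and the third lets one walk back from \<open>c\<close> to \<open>a\<close> in
  exactly \<open>d a c\<close> steps.  All three are local, so an explicit formula can be checked against
  them without producing any shortest path.
\<close>

locale distance_function =
  fixes G :: "('a, 'b) pre_digraph" and d :: "'a \<Rightarrow> 'a \<Rightarrow> nat"
  assumes dist_self: "a \<in> verts G \<Longrightarrow> d a a = 0"
    and dist_step: "a \<in> verts G \<Longrightarrow> b \<rightarrow>\<^bsub>G\<^esub> c \<Longrightarrow> d a c \<le> Suc (d a b)"
    and dist_descent: "a \<in> verts G \<Longrightarrow> c \<in> verts G \<Longrightarrow> a \<noteq> c \<Longrightarrow>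
      \<exists>b \<in> verts G. b \<rightarrow>\<^bsub>G\<^esub> c \<and> d a c = Suc (d a b)"
begin

lemma dist_along_walk:
  assumes "vwalk p G" "a \<in> verts G" "i \<le> j" "j < length p"
  shows "d a (p ! j) \<le> d a (p ! i) + (j - i)"
  using \<open>i \<le> j\<close> \<open>j < length p\<close>
proof (induction j rule: dec_induct)
  case (step k)
  have "p = take (Suc k) p @ drop (Suc k) p" "take (Suc k) p \<noteq> []" "drop (Suc k) p \<noteq> []"
    using step.prems by auto
  then have "(last (take (Suc k) p), hd (drop (Suc k) p)) \<in> set (vwalk_arcs p)"
    using vwalk_arcs_append by (metis in_set_conv_decomp)
  then have "(p ! k, p ! Suc k) \<in> set (vwalk_arcs p)"
    using step.prems by (simp add: take_Suc_conv_app_nth hd_drop_conv_nth)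
  then have "p ! k \<rightarrow>\<^bsub>G\<^esub> p ! Suc k"
    using assms(1) by (auto simp: vwalk_def)
  then have "d a (p ! Suc k) \<le> Suc (d a (p ! k))"
    using dist_step assms(2) by blast
  then show ?case using step by simp
qed simp

lemma dist_attained:
  assumes "a \<in> verts G" "c \<in> verts G"
  shows "\<exists>p. vwalk p G \<and> hd p = a \<and> last p = c \<and> length p = Suc (d a c)"
  using assms(2)
proof (induction "d a c" arbitrary: c rule: less_induct)
  case less
  show ?case
  proof (cases "a = c")
    case True
    then show ?thesis
      using less.prems dist_self by (intro exI[of _ "[a]"]) auto
  next
    case False
    then obtain b where b: "b \<in> verts G" "b \<rightarrow>\<^bsub>G\<^esub> c" "d a c = Suc (d a b)"
      using dist_descent assms(1) less.prems by blast
    then obtain p where p: "vwalk p G" "hd p = a" "last p = b" "length p = Suc (d a b)"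
      using less.hyps by fastforce
    then have "p \<noteq> []" by auto
    then have "vwalk (p @ [c]) G"
      using p b less.prems by (auto simp: vwalk_def vwalk_arcs_append)
    then show ?thesis
      using p b \<open>p \<noteq> []\<close> by (intro exI[of _ "p @ [c]"]) auto
  qed
qed

lemma dist_triangle:
  assumes "a \<in> verts G" "b \<in> verts G" "c \<in> verts G"
  shows "d a c \<le> d a b + d b c"
proof -
  obtain p where p: "vwalk p G" "hd p = b" "last p = c" "length p = Suc (d b c)"
    using dist_attained assms by blast
  then have "p ! 0 = b" "p ! d b c = c"
    by (metis hd_conv_nth vwalkE, metis diff_Suc_1 last_conv_nth vwalkE)
  then show ?thesis
    using dist_along_walk[OF p(1) assms(1), of 0 "d b c"] p(4) by simp
qed

text \<open>
  If some stretch of the walk could be shortened, the triangle inequality would shorten the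
  whole walk.
\<close>

lemma dist_within_geodesic:
  assumes p: "vwalk p G" "length p = Suc (d (hd p) (last p))"
    and ij: "i \<le> j" "j < length p"
  shows "d (p ! i) (p ! j) = j - i"
proof -
  have inV: "p ! k \<in> verts G" if "k < length p" for k
    using p(1) that by (auto simp: vwalk_def)
  have le: "d (p ! k) (p ! l) \<le> l - k" if "k \<le> l" "l < length p" for k l
    using dist_along_walk[OF p(1) inV, of k k l] dist_self inV that by simp
  have ne: "p \<noteq> []" using p(1) by auto
  let ?m = "length p - 1"
  have "?m = d (p ! 0) (p ! ?m)"
    using p(2) ne by (simp add: hd_conv_nth last_conv_nth)
  also have "\<dots> \<le> d (p ! 0) (p ! i) + (d (p ! i) (p ! j) + d (p ! j) (p ! ?m))"
    using dist_triangle[of "p ! 0" "p ! i" "p ! ?m"] dist_triangle[of "p ! i" "p ! j" "p ! ?m"]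
      inV ij ne by fastforce
  also have "\<dots> \<le> i + (d (p ! i) (p ! j) + (?m - j))"
    using le[of 0 i] le[of j ?m] ij ne by (cases p) auto
  finally show ?thesis using le[OF ij] ij by simp
qed

text \<open>
  The definition of shortest path only competes with paths, so a walk of length \<open>d\<close> has to be
  shown to repeat no vertex: two equal vertices would be at distance zero but, by the previous
  lemma, at a positive distance.
\<close>

lemma geodesic_is_shortest_vpath:
  assumes "vwalk p G" "length p = Suc (d (hd p) (last p))"
  shows "shortest_vpath G p"
proof -
  have "distinct p"
    unfolding distinct_conv_nth
  proof (intro allI impI)
    fix i j assume "i < length p" "j < length p" "i \<noteq> j"
    moreover have "p ! k \<noteq> p ! l" if "k < l" "l < length p" for k l
    proof
      assume "p ! k = p ! l"
      moreover have "d (p ! k) (p ! l) = l - k" "d (p ! k) (p ! k) = k - k"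
        using dist_within_geodesic[OF assms] that by auto
      ultimately show False using that by simp
    qed
    ultimately show "p ! i \<noteq> p ! j" by (metis nat_neq_iff)
  qed
  moreover have "vwalk_length p \<le> vwalk_length q"
    if q: "vpath q G" "hd q = hd p" "last q = last p" for q
  proof -
    have w: "vwalk q G" "q \<noteq> []" "hd q \<in> verts G"
      using q(1) by (auto simp: vpath_def vwalk_def)
    then have "d (hd q) (last q) \<le> length q - 1"
      using dist_along_walk[of q "hd q" 0 "length q - 1"] dist_self
      by (simp add: hd_conv_nth last_conv_nth)
    then show ?thesis using assms(2) q by simp
  qed
  ultimately show ?thesis
    using assms(1) by (auto simp: shortest_vpath_def)
qed

lemma shortest_vpath_is_geodesic:
  assumes "shortest_vpath G p"
  shows "vwalk p G" "length p = Suc (d (hd p) (last p))"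
proof -
  show w: "vwalk p G" using assms by (auto simp: shortest_vpath_def)
  then have V: "p \<noteq> []" "hd p \<in> verts G" "last p \<in> verts G" by (auto simp: vwalk_def)
  then obtain q where q: "vwalk q G" "hd q = hd p" "last q = last p"
      "length q = Suc (d (hd p) (last p))"
    using dist_attained by metis
  then have "vpath q G"
    using geodesic_is_shortest_vpath by (simp add: shortest_vpath_def)
  then have "length p - 1 \<le> length q - 1"
    using assms q by (auto simp: shortest_vpath_def)
  moreover have "d (hd p) (last p) \<le> length p - 1"
    using dist_along_walk[of p "hd p" 0 "length p - 1"] dist_self w V
    by (simp add: hd_conv_nth last_conv_nth)
  ultimately show "length p = Suc (d (hd p) (last p))"
    using q(4) V(1) by (cases p) auto
qed

text \<open>
  Three vertices lie on a common shortest path exactly if, in some order, the triangle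
  inequality is an equality for them: distances add up along a geodesic, and conversely two
  geodesics whose lengths add up to the distance of their outer ends concatenate to one.
\<close>

theorem general_position_set_iff_no_collinear_triple:
  "general_position_set G S \<longleftrightarrow> S \<subseteq> verts G \<and>
    (\<forall>a \<in> S. \<forall>b \<in> S. \<forall>c \<in> S. distinct [a, b, c] \<longrightarrow> d a c \<noteq> d a b + d b c)"
proof -
  have "\<exists>a \<in> S. \<exists>b \<in> S. \<exists>c \<in> S. distinct [a, b, c] \<and> d a c = d a b + d b c"
    if p: "shortest_vpath G p" "card (set p \<inter> S) \<ge> 3" for p
  proof -
    obtain T where T: "T \<subseteq> set p \<inter> S" "card T = 3"
      using p(2) by (meson obtain_subset_with_card_n)
    then obtain u v w where uvw: "u \<in> set p \<inter> S" "v \<in> set p \<inter> S" "w \<in> set p \<inter> S"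
        "u \<noteq> v" "v \<noteq> w" "u \<noteq> w"
      by (auto simp: card_3_iff)
    then obtain i j k where "i < length p" "p ! i = u" "j < length p" "p ! j = v"
        "k < length p" "p ! k = w"
      by (auto simp: in_set_conv_nth)
    then have ijk: "i < length p" "j < length p" "k < length p"
        "p ! i \<in> S" "p ! j \<in> S" "p ! k \<in> S" "p ! i \<noteq> p ! j" "p ! j \<noteq> p ! k" "p ! i \<noteq> p ! k"
      using uvw by auto
    have ordered: ?thesis if "i < j" "j < k" "k < length p" "p ! i \<in> S" "p ! j \<in> S" "p ! k \<in> S"
        "p ! i \<noteq> p ! j" "p ! j \<noteq> p ! k" "p ! i \<noteq> p ! k" for i j k
      using that dist_within_geodesic[OF shortest_vpath_is_geodesic[OF p(1)]]
      by (intro bexI[of _ "p ! i"] bexI[of _ "p ! j"] bexI[of _ "p ! k"]) auto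
    have "i \<noteq> j" "j \<noteq> k" "i \<noteq> k" using ijk by auto
    then consider "i < j" "j < k" | "i < k" "k < j" | "j < i" "i < k" | "j < k" "k < i"
      | "k < i" "i < j" | "k < j" "j < i"
      by linarith
    then show ?thesis
      using ijk ordered[of i j k] ordered[of i k j] ordered[of j i k] ordered[of j k i]
        ordered[of k i j] ordered[of k j i]
      by cases presburger+
  qed
  moreover have "\<exists>p. shortest_vpath G p \<and> card (set p \<inter> S) \<ge> 3"
    if S: "S \<subseteq> verts G" and abc: "a \<in> S" "b \<in> S" "c \<in> S" "distinct [a, b, c]"
      "d a c = d a b + d b c" for a b c
  proof -
    have V: "a \<in> verts G" "b \<in> verts G" "c \<in> verts G" using S abc by auto
    obtain p where p: "vwalk p G" "hd p = a" "last p = b" "length p = Suc (d a b)"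
      using dist_attained V by blast
    obtain bq where bq: "vwalk bq G" "hd bq = b" "last bq = c" "length bq = Suc (d b c)"
      using dist_attained V by blast
    then obtain q where "bq = b # q"
      by (cases bq) auto
    then have q: "vwalk (b # q) G" "last (b # q) = c" "length q = d b c"
      using bq by auto
    have ne: "p \<noteq> []" "q \<noteq> []"
      using p q abc(4) by auto
    let ?r = "p @ q"
    have "vwalk ?r G"
      using p q ne by (auto simp: vwalk_def vwalk_arcs_append)
    moreover have "hd ?r = a" "last ?r = c" "length ?r = Suc (d a c)"
      using p q ne abc(5) by auto
    ultimately have "shortest_vpath G ?r"
      using geodesic_is_shortest_vpath by simp
    moreover have "a \<in> set p" "b \<in> set p" "c \<in> set q"
      using p q ne hd_in_set last_in_set by fastforce+
    then have "{a, b, c} \<subseteq> set ?r \<inter> S"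
      using abc by auto
    then have "card {a, b, c} \<le> card (set ?r \<inter> S)" by (intro card_mono) auto
    then have "card (set ?r \<inter> S) \<ge> 3" using abc(4) by simp
    ultimately show ?thesis by blast
  qed
  ultimately show ?thesis
    unfolding general_position_set_def by blast
qed

end

section \<open>Distances in the Mycielskian\<close>

text \<open>
  Any detour can be routed through the root, which is at distance 2 from the originals and 1
  from the copies.  Hence, for distinct vertices of \<open>G\<close>, two originals are at the
  distance in \<open>G\<close> cut off at 4, and an original and a copy at the distance in \<open>G\<close> cut off at 3.  The composition of arcs need not
  be a shortest walk: with \<open>u = v\<close>, going to a neighbour and back yields the distance 2
  between an original and its own copy, so that this case needs no clause of its own.
\<close>

fun mycielski_dist ::
    "'a pair_pre_digraph \<Rightarrow> 'a mycielski_vertex \<Rightarrow> 'a mycielski_vertex \<Rightarrow> nat" where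
  "mycielski_dist G (Orig u) (Orig v) =
     (if u = v then 0 else if (u, v) \<in> parcs G then 1
      else if (u, v) \<in> parcs G O parcs G then 2
      else if (u, v) \<in> parcs G O parcs G O parcs G then 3 else 4)"
| "mycielski_dist G (Orig u) (Copy v) =
     (if (u, v) \<in> parcs G then 1 else if (u, v) \<in> parcs G O parcs G then 2 else 3)"
| "mycielski_dist G (Copy u) (Orig v) =
     (if (u, v) \<in> parcs G then 1 else if (u, v) \<in> parcs G O parcs G then 2 else 3)"
| "mycielski_dist G (Copy u) (Copy v) = (if u = v then 0 else 2)"
| "mycielski_dist G Root (Orig v) = 2"
| "mycielski_dist G (Orig v) Root = 2"
| "mycielski_dist G Root (Copy v) = 1"
| "mycielski_dist G (Copy v) Root = 1"
| "mycielski_dist G Root Root = 0"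

lemma mycielskian_arc_simps [simp]:
  "(Orig u, Orig v) \<in> parcs (mycielskian G) \<longleftrightarrow> (u, v) \<in> parcs G"
  "(Orig u, Copy v) \<in> parcs (mycielskian G) \<longleftrightarrow> (u, v) \<in> parcs G"
  "(Copy u, Orig v) \<in> parcs (mycielskian G) \<longleftrightarrow> (u, v) \<in> parcs G"
  "(Copy u, Root) \<in> parcs (mycielskian G) \<longleftrightarrow> u \<in> pverts G"
  "(Root, Copy u) \<in> parcs (mycielskian G) \<longleftrightarrow> u \<in> pverts G"
  "(Copy u, Copy v) \<notin> parcs (mycielskian G)"
  "(Orig u, Root) \<notin> parcs (mycielskian G)"
  "(Root, Orig u) \<notin> parcs (mycielskian G)"
  "(Root, Root) \<notin> parcs (mycielskian G)"
  by (auto simp: mycielskian_def)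

lemma mycielskian_vertex_simps [simp]:
  "Orig u \<in> pverts (mycielskian G) \<longleftrightarrow> u \<in> pverts G"
  "Copy u \<in> pverts (mycielskian G) \<longleftrightarrow> u \<in> pverts G"
  "Root \<in> pverts (mycielskian G)"
  by (auto simp: mycielskian_def)

text \<open>
  A vertex without neighbours would be cut off from its copy, and the formula for distances
  would fail; every connected graph with at least two vertices belongs to this locale.
\<close>

locale isolate_free_graph = pair_graph G for G :: "'a pair_pre_digraph" +
  assumes has_neighbour: "u \<in> pverts G \<Longrightarrow> \<exists>v. (u, v) \<in> parcs G"
begin

lemma arc_sym: "(u, v) \<in> parcs G \<Longrightarrow> (v, u) \<in> parcs G"
  using arcs_symmetric by auto

lemma two_step_refl: "u \<in> pverts G \<Longrightarrow> (u, u) \<in> parcs G O parcs G"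
  using has_neighbour arc_sym by blast

lemma distance_function_mycielskian:
  "distance_function (mycielskian G) (mycielski_dist G)"
proof (unfold_locales, goal_cases)
  case (1 a)
  then show ?case by (cases a) auto
next
  case (2 a b c)
  then show ?case
    by (cases a; cases b; cases c)
      (auto dest: in_arcsD1 in_arcsD2 arc_sym two_step_refl)
next
  case (3 a c)
  have start: "\<exists>b. (b, u) \<in> parcs G" if "u \<in> pverts G" for u
    using has_neighbour arc_sym that by blast
  have "\<exists>b. (b, c) \<in> parcs (mycielskian G) \<and> mycielski_dist G a c = Suc (mycielski_dist G a b)"
  proof (cases a)
    case a: (Orig u)
    with 3 have u: "u \<in> pverts G" by simp
    show ?thesis
    proof (cases c)
      case c: (Orig v)
      with 3 a have v: "v \<in> pverts G" "u \<noteq> v" by auto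
      consider "(u, v) \<in> parcs G" | "(u, v) \<notin> parcs G" "(u, v) \<in> parcs G O parcs G"
        | "(u, v) \<notin> parcs G" "(u, v) \<notin> parcs G O parcs G"
          "(u, v) \<in> parcs G O parcs G O parcs G"
        | "(u, v) \<notin> parcs G" "(u, v) \<notin> parcs G O parcs G"
          "(u, v) \<notin> parcs G O parcs G O parcs G"
        by blast
      then show ?thesis
      proof cases
        case 1
        then show ?thesis using a c v by (intro exI[of _ "Orig u"]) auto
      next
        case 2
        then obtain w where "(u, w) \<in> parcs G" "(w, v) \<in> parcs G" by blast
        then show ?thesis using a c v 2 by (intro exI[of _ "Copy w"]) auto
      next
        case 3
        then obtain w where w: "(u, w) \<in> parcs G O parcs G" "(w, v) \<in> parcs G" by blast
        then have "(u, w) \<notin> parcs G" using 3 by blast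
        then show ?thesis using a c v w 3 by (intro exI[of _ "Copy w"]) auto
      next
        case 4
        obtain w where w: "(w, v) \<in> parcs G" using start v by blast
        then have "(u, w) \<notin> parcs G" "(u, w) \<notin> parcs G O parcs G" using 4 by blast+
        then show ?thesis using a c v w 4 by (intro exI[of _ "Copy w"]) auto
      qed
    next
      case c: (Copy v)
      with 3 have v: "v \<in> pverts G" by simp
      consider "(u, v) \<in> parcs G" | "(u, v) \<notin> parcs G" "(u, v) \<in> parcs G O parcs G"
        | "(u, v) \<notin> parcs G" "(u, v) \<notin> parcs G O parcs G"
        by blast
      then show ?thesis
      proof cases
        case 1
        then show ?thesis using a c by (intro exI[of _ "Orig u"]) auto
      next
        case 2
        then obtain w where "(u, w) \<in> parcs G" "(w, v) \<in> parcs G" by blast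
        then show ?thesis using a c 2 no_loops' by (intro exI[of _ "Orig w"]) auto
      next
        case 3
        then show ?thesis using a c v by (intro exI[of _ Root]) auto
      qed
    next
      case Root
      obtain w where "(u, w) \<in> parcs G" using has_neighbour u by blast
      then show ?thesis using a Root in_arcsD2 by (intro exI[of _ "Copy w"]) auto
    qed
  next
    case a: (Copy u)
    with 3 have u: "u \<in> pverts G" by simp
    show ?thesis
    proof (cases c)
      case c: (Orig v)
      with 3 have v: "v \<in> pverts G" by simp
      consider "(u, v) \<in> parcs G" | "(u, v) \<notin> parcs G" "(u, v) \<in> parcs G O parcs G"
        | "(u, v) \<notin> parcs G" "(u, v) \<notin> parcs G O parcs G"
        by blast
      then show ?thesis
      proof cases
        case 1
        then show ?thesis using a c by (intro exI[of _ "Copy u"]) auto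
      next
        case 2
        then obtain w where "(u, w) \<in> parcs G" "(w, v) \<in> parcs G" by blast
        then show ?thesis using a c 2 by (intro exI[of _ "Orig w"]) auto
      next
        case 3
        obtain w where "(w, v) \<in> parcs G" using start v by blast
        then show ?thesis using a c 3 by (intro exI[of _ "Copy w"]) auto
      qed
    next
      case c: (Copy v)
      then show ?thesis using 3 a by (intro exI[of _ Root]) auto
    next
      case Root
      then show ?thesis using a u by (intro exI[of _ "Copy u"]) auto
    qed
  next
    case a: Root
    show ?thesis
    proof (cases c)
      case c: (Orig v)
      with 3 obtain w where "(w, v) \<in> parcs G" using start by auto
      then show ?thesis using a c by (intro exI[of _ "Copy w"]) auto
    next
      case c: (Copy v)
      then show ?thesis using 3 a by (intro exI[of _ Root]) auto
    next
      case Root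
      then show ?thesis using 3 a by simp
    qed
  qed
  moreover have "b \<in> pverts (mycielskian G)" if "(b, c) \<in> parcs (mycielskian G)" for b
    using that by (auto simp: mycielskian_def dest: in_arcsD1 in_arcsD2)
  ultimately show ?case by auto
qed

lemmas general_position_set_mycielskian_iff =
  distance_function.general_position_set_iff_no_collinear_triple
    [OF distance_function_mycielskian, simplified with_proj_simps]

end

section \<open>Extremal sets and cardinalities\<close>

lemma independent_set_pair_iff:
  "independent_set (with_proj G) I \<longleftrightarrow>
    I \<subseteq> pverts G \<and> (\<forall>u \<in> I. \<forall>v \<in> I. u \<noteq> v \<longrightarrow> (u, v) \<notin> parcs G)"
  by (auto simp: independent_set_def pairwise_def)

lemma arcs_ends_induce_subgraph:
  "arcs_ends ((with_proj G) \<restriction> S) = {(u, v) \<in> parcs G. u \<in> S \<and> v \<in> S}"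
  by (auto simp: arcs_ends_conv)

lemma finite_card_independent_sets:
  assumes "finite (verts G)"
  shows "finite (card ` {I. independent_set G I})"
  using assms by (auto simp: independent_set_def intro: finite_subset[of _ "Pow (verts G)"])

lemma card_independent_set_le:
  assumes "finite (verts G)" "independent_set G I"
  shows "card I \<le> independence_number G"
  unfolding independence_number_def
  using finite_card_independent_sets[OF assms(1)] assms(2) by (intro Max_ge) auto

lemma independence_number_attained:
  assumes "finite (verts G)"
  obtains I where "independent_set G I" "card I = independence_number G"
proof -
  have "independent_set G {}" by (simp add: independent_set_def)
  then have "independence_number G \<in> card ` {I. independent_set G I}"
    unfolding independence_number_def
    using finite_card_independent_sets[OF assms] by (intro Max_in) auto
  then show ?thesis using that by auto
qed

lemma gp_number_eq_iff_attained:
  assumes "finite (verts G)" "\<And>S. general_position_set G S \<Longrightarrow> card S \<le> m"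
  shows "gp_number G = m \<longleftrightarrow> (\<exists>S. general_position_set G S \<and> card S = m)"
proof -
  let ?cards = "card ` {S. general_position_set G S}"
  have "finite ?cards"
    using assms(1)
    by (auto simp: general_position_set_def intro: finite_subset[of _ "Pow (verts G)"])
  moreover have "general_position_set G {}" by (simp add: general_position_set_def)
  ultimately have "gp_number G = m \<longleftrightarrow> m \<in> ?cards \<and> (\<forall>k \<in> ?cards. k \<le> m)"
    unfolding gp_number_def by (intro Max_eq_iff) auto
  then show ?thesis using assms(2) by auto
qed

context isolate_free_graph
begin

lemma card_independent_le: "independent_set G I \<Longrightarrow> card I \<le> independence_number G"
  using card_independent_set_le[of "with_proj G"] pair_finite_verts by simp

lemma no_collinear_triple:
  assumes "general_position_set (mycielskian G) S" "a \<in> S" "b \<in> S" "c \<in> S" "distinct [a, b, c]"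
  shows "mycielski_dist G a c \<noteq> mycielski_dist G a b + mycielski_dist G b c"
  using assms general_position_set_mycielskian_iff by blast

lemma card_mycielski_set:
  assumes "general_position_set (mycielskian G) S"
  shows "card S = card {u. Orig u \<in> S} + card {u. Copy u \<in> S} + (if Root \<in> S then 1 else 0)"
proof -
  let ?A = "{u. Orig u \<in> S}" and ?B = "{u. Copy u \<in> S}" and ?R = "S \<inter> {Root}"
  have sub: "S \<subseteq> pverts (mycielskian G)"
    using assms by (simp add: general_position_set_def)
  then have "?A \<subseteq> pverts G" "?B \<subseteq> pverts G" by auto
  then have fin: "finite ?A" "finite ?B"
    using pair_finite_verts finite_subset by blast+
  have "S = Orig ` ?A \<union> Copy ` ?B \<union> ?R"
  proof (intro equalityI subsetI)
    fix z assume "z \<in> S"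
    then show "z \<in> Orig ` ?A \<union> Copy ` ?B \<union> ?R" by (cases z) auto
  qed auto
  then have "card S = card (Orig ` ?A \<union> Copy ` ?B \<union> ?R)" by simp
  also have "\<dots> = card (Orig ` ?A) + card (Copy ` ?B) + card ?R"
    using fin by (subst card_Un_disjoint, force, force, force)+ simp
  also have "\<dots> = card ?A + card ?B + card ?R"
    by (simp add: card_image inj_on_def)
  finally show ?thesis by auto
qed

text \<open>
  Two non-adjacent vertices besides the leaf would both differ from its neighbour, and then
  they would form an independent set of size three with the leaf.
\<close>

lemma clique_with_leafI:
  assumes "independence_number G \<le> 2"
    and l: "(l, u) \<in> parcs G" "\<And>w. (l, w) \<in> parcs G \<Longrightarrow> w = u"
    and u: "\<And>w. w \<in> pverts G \<Longrightarrow> w \<noteq> u \<Longrightarrow> (w, u) \<in> parcs G"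
  shows "clique_with_leaf G"
proof -
  let ?H = "(with_proj G) \<restriction> (pverts G - {l})"
  have lV: "l \<in> pverts G" using l in_arcsD1 by blast
  have "out_arcs G l = {(l, u)}"
    using l(1) by (auto simp: out_arcs_def dest: l(2))
  then have deg: "out_degree G l = 1" by (simp add: out_degree_def)
  have clique: "(w, z) \<in> parcs G"
    if wz: "w \<in> pverts G" "z \<in> pverts G" "w \<noteq> z" "w \<noteq> l" "z \<noteq> l" for w z
  proof (rule ccontr)
    assume *: "(w, z) \<notin> parcs G"
    have "w \<noteq> u" "z \<noteq> u" using * wz u arc_sym by blast+
    then have "(l, w) \<notin> parcs G" "(l, z) \<notin> parcs G" using l(2) by blast+
    then have "independent_set G {l, w, z}"
      using wz * lV arc_sym unfolding independent_set_pair_iff by blast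
    then have "card {l, w, z} \<le> 2"
      using card_independent_le assms(1) order_trans by blast
    then show False using wz by auto
  qed
  have ind: "induced_subgraph ?H G"
    by (rule induced_induce) auto
  then have "graph ?H"
    using digraphI_induced induced_graph_imp_graph
    by (simp add: graph_def pseudo_graph_def digraph_def)
  moreover have "arcs_ends ?H = {(w, z). (w, z) \<in> verts ?H \<times> verts ?H \<and> w \<noteq> z}"
    unfolding arcs_ends_induce_subgraph using clique
    by (auto dest: in_arcsD1 in_arcsD2 no_loops')
  moreover have "card (verts ?H) = card (pverts G) - 1"
    using lV pair_finite_verts by simp
  ultimately have "K\<^bsub>card (pverts G) - 1\<^esub> ?H"
    by (simp add: complete_digraph_def)
  then show ?thesis
    using lV deg by (auto simp: clique_with_leaf_def)
qed

end

section \<open>The upper bound and the graphs that attain it\<close>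

text \<open>
  For a general position set \<open>S\<close> of the Mycielskian, the arguments speak about the two subsets
  of vertices of \<open>G\<close> that occur in \<open>S\<close> as originals and as copies.  A vertex in both is called
  doubled.
\<close>

locale mycielskian_gp_set = isolate_free_graph G for G :: "'a pair_pre_digraph" +
  fixes S :: "'a mycielski_vertex set"
  assumes gp: "general_position_set (mycielskian G) S"
begin

definition originals :: "'a set" where
  "originals = {u. Orig u \<in> S}"

definition copies :: "'a set" where
  "copies = {u. Copy u \<in> S}"

lemma in_originals: "u \<in> originals \<longleftrightarrow> Orig u \<in> S"
  and in_copies: "u \<in> copies \<longleftrightarrow> Copy u \<in> S"
  by (auto simp: originals_def copies_def)

lemma originals_subset: "originals \<subseteq> pverts G" and copies_subset: "copies \<subseteq> pverts G"
  using gp by (auto simp: originals_def copies_def general_position_set_def)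

lemma finite_originals: "finite originals" and finite_copies: "finite copies"
  using originals_subset copies_subset pair_finite_verts finite_subset by blast+

text \<open>
  The next four facts exclude the collinear triples that matter: an original between two copies;
  a copy between an original and a copy at distance 3; an original between a doubled vertex and
  its copy; and a copy between two originals.
\<close>

lemma copies_at_common_neighbour:
  assumes "u \<in> originals" "v \<in> copies" "w \<in> copies" "(u, v) \<in> parcs G" "(u, w) \<in> parcs G"
  shows "v = w"
proof (rule ccontr)
  assume "v \<noteq> w"
  then show False
    using no_collinear_triple[OF gp, of "Copy v" "Orig u" "Copy w"] assms arc_sym
    by (auto simp: in_originals in_copies)
qed

lemma copies_within_two:
  assumes "u \<in> originals" "v \<in> copies" "w \<in> copies" "(u, v) \<in> parcs G" "v \<noteq> w"
  shows "(u, w) \<in> parcs G O parcs G"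
proof -
  have "(u, w) \<notin> parcs G"
    using copies_at_common_neighbour assms by blast
  then show ?thesis
    using no_collinear_triple[OF gp, of "Orig u" "Copy v" "Copy w"] assms
    by (auto simp: in_originals in_copies split: if_splits)
qed

lemma doubled_not_adjacent_to_original:
  assumes "u \<in> originals" "w \<in> originals" "w \<in> copies"
  shows "(u, w) \<notin> parcs G"
proof
  assume uw: "(u, w) \<in> parcs G"
  have "(w, w) \<notin> parcs G" "(w, w) \<in> parcs G O parcs G" "u \<noteq> w"
    using no_loops' two_step_refl uw in_arcsD2 by auto
  then show False
    using no_collinear_triple[OF gp, of "Copy w" "Orig u" "Orig w"] uw assms arc_sym[OF uw]
    by (auto simp: in_originals in_copies)
qed

lemma originals_at_common_copy:
  assumes "u \<in> originals" "w \<in> originals" "v \<in> copies" "(u, v) \<in> parcs G" "(v, w) \<in> parcs G"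
    and "u \<noteq> w"
  shows "(u, w) \<in> parcs G"
proof (rule ccontr)
  assume "(u, w) \<notin> parcs G"
  moreover have "(u, w) \<in> parcs G O parcs G" using assms by blast
  ultimately show False
    using no_collinear_triple[OF gp, of "Orig u" "Copy v" "Orig w"] assms
    by (auto simp: in_originals in_copies)
qed

lemma independent_doubled: "independent_set G (originals \<inter> copies)"
  using originals_subset doubled_not_adjacent_to_original
  unfolding independent_set_pair_iff by blast

lemma card_doubled_le: "card (originals \<inter> copies) \<le> independence_number G"
  using card_independent_le independent_doubled by blast

text \<open>
  This is the source of the bound: the union has at most all vertices of \<open>G\<close>, and the doubled
  vertices are independent.
\<close>

lemma card_eq_union_plus_doubled:
  assumes "Root \<notin> S"
  shows "card S = card (originals \<union> copies) + card (originals \<inter> copies)"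
  using card_mycielski_set[OF gp] card_Un_Int[OF finite_originals finite_copies] assms
  by (simp add: originals_def copies_def)

text \<open>
  The pivotal fact.  Since the doubled vertex \<open>w\<close> is also a copy, it has to be within distance 2 of
  \<open>u\<close>.  The middle vertex cannot be an original next to a doubled vertex, and it cannot
  be a copy either: \<open>v\<close> is the only copy next to \<open>u\<close>, so it would be \<open>v\<close>, and the copy of \<open>v\<close>
  would lie between the originals \<open>u\<close> and \<open>w\<close>.
\<close>

lemma doubled_share_unused_neighbour:
  assumes u: "u \<in> originals \<inter> copies" and w: "w \<in> originals \<inter> copies" and "u \<noteq> w"
    and v: "v \<in> copies" "(u, v) \<in> parcs G"
  shows "\<exists>x. (u, x) \<in> parcs G \<and> (x, w) \<in> parcs G \<and> x \<notin> originals \<union> copies"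
proof -
  have uw: "(u, w) \<notin> parcs G"
    using u w doubled_not_adjacent_to_original by blast
  then have "v \<noteq> w" using v by blast
  then obtain x where x: "(u, x) \<in> parcs G" "(x, w) \<in> parcs G"
    using copies_within_two u v w by blast
  have "x \<notin> originals"
    using doubled_not_adjacent_to_original u x arc_sym by blast
  moreover have "x \<notin> copies"
    using copies_at_common_neighbour[of u v x] originals_at_common_copy[of u w v]
      u v w x uw \<open>u \<noteq> w\<close> by blast
  ultimately show ?thesis using x by blast
qed

text \<open>
  This saves the one vertex that separates \<open>n + \<alpha> - 1\<close> from the trivial bound \<open>n + \<alpha>\<close>: a
  neighbour of a doubled vertex either is itself unused or is a copy, and then the previous
  lemma applies.
\<close>

lemma two_doubled_imp_unused_vertex:
  assumes "card (originals \<inter> copies) \<ge> 2"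
  shows "originals \<union> copies \<noteq> pverts G"
proof -
  obtain u w where uw: "u \<in> originals \<inter> copies" "w \<in> originals \<inter> copies" "u \<noteq> w"
    using assms card_le_Suc0_iff_eq[of "originals \<inter> copies"] finite_originals by force
  then obtain v where v: "(u, v) \<in> parcs G" using has_neighbour originals_subset by blast
  show ?thesis
  proof (cases "v \<in> copies")
    case True
    then obtain x where "(u, x) \<in> parcs G" "x \<notin> originals \<union> copies"
      using doubled_share_unused_neighbour uw v by blast
    then show ?thesis using in_arcsD2 by blast
  next
    case False
    moreover have "v \<notin> originals"
      using doubled_not_adjacent_to_original uw v arc_sym by blast
    ultimately show ?thesis using v in_arcsD2 by blast
  qed
qed

text \<open>
  No neighbour of the doubled vertex \<open>u\<close> is an original, so all are copies, and there is only one,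
  say \<open>v\<close>.  Every other vertex is adjacent to \<open>v\<close>: a copy because it is within distance 2 of
  \<open>u\<close>, and an original because otherwise the copy of \<open>v\<close> would lie between it and \<open>u\<close>.
\<close>

lemma leaf_with_copy_everywhere:
  assumes all: "originals \<union> copies = pverts G" and one: "originals \<inter> copies = {u}"
    and \<alpha>: "independence_number G \<le> 2"
  shows "clique_with_leaf G"
proof -
  have u: "u \<in> originals" "u \<in> copies" using one by auto
  have nbr_copy: "w \<in> copies" if "(u, w) \<in> parcs G" for w
    using doubled_not_adjacent_to_original[of w u] u arc_sym[OF that] in_arcsD2[OF that] all
    by blast
  obtain v where v: "(u, v) \<in> parcs G"
    using has_neighbour u originals_subset by blast
  have leaf: "w = v" if "(u, w) \<in> parcs G" for w
    using copies_at_common_neighbour u nbr_copy that v by blast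
  have two: "(v, w) \<in> parcs G" if "(u, w) \<in> parcs G O parcs G" for w
    using that leaf by blast
  have "(w, v) \<in> parcs G" if w: "w \<in> pverts G" "w \<noteq> v" for w
  proof (cases "w = u")
    case True
    then show ?thesis using v by simp
  next
    case False
    consider "w \<in> copies" | "w \<in> originals" using w all by blast
    then show ?thesis
    proof cases
      case 1
      then show ?thesis
        using copies_within_two[of u v w] u v nbr_copy w two arc_sym by blast
    next
      case 2
      \<comment> \<open>As \<open>v\<close> is the only neighbour of \<open>u\<close>, the original \<open>w\<close> is one step further from \<open>u\<close> than from
        \<open>v\<close>; the cut-offs 4 and 3 preserve this, so the copy of \<open>v\<close> lies between \<open>u\<close> and \<open>w\<close>.\<close>
      have "(v, w) \<in> parcs G"
      proof (rule ccontr)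
        assume vw: "(v, w) \<notin> parcs G"
        have "(u, w) \<notin> parcs G" "(u, w) \<notin> parcs G O parcs G"
          using vw two leaf w by blast+
        moreover have "(u, w) \<in> parcs G O parcs G O parcs G \<longleftrightarrow> (v, w) \<in> parcs G O parcs G"
          using v leaf by blast
        ultimately show False
          using no_collinear_triple[OF gp, of "Orig u" "Copy v" "Orig w"] u v vw 2 False nbr_copy
          by (auto simp: in_originals in_copies split: if_splits)
      qed
      then show ?thesis by (rule arc_sym)
    qed
  qed
  then show ?thesis
    using clique_with_leafI[OF \<alpha> v] leaf by blast
qed

lemma copies_singleton_if_root:
  assumes "Root \<in> S" "v \<in> copies"
  shows "copies = {v}"
proof -
  have "w = v" if "w \<in> copies" for w
    using no_collinear_triple[OF gp, of "Copy v" Root "Copy w"] assms that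
    by (auto simp: in_copies split: if_splits)
  then show ?thesis using assms(2) by blast
qed

text \<open>
  At distance 1 the copy would lie between the root and the original; at distance 3 the root
  would lie between the copy and the original.
\<close>

lemma root_copy_original_two_apart:
  assumes "Root \<in> S" "v \<in> copies" "u \<in> originals"
  shows "(v, u) \<notin> parcs G" "(v, u) \<in> parcs G O parcs G"
  using no_collinear_triple[OF gp, of Root "Copy v" "Orig u"]
    no_collinear_triple[OF gp, of "Copy v" Root "Orig u"] assms
  by (auto simp: in_originals in_copies split: if_splits)

text \<open>
  Non-adjacent \<open>p\<close> and \<open>q\<close> at distance 2 or 3 have a vertex of \<open>G\<close> between them, and at distance 4
  the root is between them.
\<close>

lemma originals_neq_all_if_root:
  assumes "Root \<in> S" and pq: "p \<in> pverts G" "q \<in> pverts G" "p \<noteq> q" "(p, q) \<notin> parcs G"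
  shows "originals \<noteq> pverts G"
proof
  assume "originals = pverts G"
  then have O: "Orig u \<in> S" if "u \<in> pverts G" for u
    using that in_originals by blast
  have two: "(p, q) \<notin> parcs G O parcs G"
  proof
    assume "(p, q) \<in> parcs G O parcs G"
    then obtain m where "(p, m) \<in> parcs G" "(m, q) \<in> parcs G" by blast
    then show False
      using no_collinear_triple[OF gp, of "Orig p" "Orig m" "Orig q"] O pq in_arcsD2 no_loops'
      by (auto split: if_splits)
  qed
  have three: "(p, q) \<notin> parcs G O parcs G O parcs G"
  proof
    assume "(p, q) \<in> parcs G O parcs G O parcs G"
    then obtain m where m: "(p, m) \<in> parcs G" "(m, q) \<in> parcs G O parcs G" by blast
    then have "(m, q) \<notin> parcs G" "m \<noteq> q" "m \<noteq> p"
      using two pq no_loops' by blast+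
    then show False
      using no_collinear_triple[OF gp, of "Orig p" "Orig m" "Orig q"] O pq in_arcsD2[OF m(1)] m two
      by (auto split: if_splits)
  qed
  show False
    using no_collinear_triple[OF gp, of "Orig p" Root "Orig q"] O assms two three by auto
qed

text \<open>
  With the root there is at most one copy, so the set has at most \<open>n + 1\<close> elements, which is
  within the bound as \<open>\<alpha>\<close> is at least 2.  In the case of equality all but one vertex are originals.
  The neighbours of the single copy \<open>v\<close> are not, so \<open>v\<close> has one neighbour \<open>u\<close>, and distance
  2 from \<open>v\<close> makes every other vertex a neighbour of \<open>u\<close>.
\<close>

lemma root_case:
  assumes "Root \<in> S" and \<alpha>: "independence_number G \<ge> 2"
    and pq: "p \<in> pverts G" "q \<in> pverts G" "p \<noteq> q" "(p, q) \<notin> parcs G"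
  defines "N \<equiv> card (pverts G) + independence_number G - 1"
  shows "card S \<le> N \<and> (card S = N \<longrightarrow> clique_with_leaf G)"
proof -
  have lt: "card originals < card (pverts G)"
    using originals_neq_all_if_root[OF assms(1) pq] originals_subset pair_finite_verts
    by (simp add: psubset_card_mono psubsetI)
  have cS: "card S = card originals + card copies + 1"
    using card_mycielski_set[OF gp] assms(1) by (simp add: originals_def copies_def)
  show ?thesis
  proof (cases "copies = {}")
    case True
    then show ?thesis using lt cS \<alpha> by (auto simp: N_def)
  next
    case False
    then obtain v where v: "v \<in> copies" by blast
    have one: "card copies = 1" using copies_singleton_if_root[OF assms(1) v] by simp
    have "clique_with_leaf G" if eq: "card S = N"
    proof -
      have \<alpha>2: "independence_number G \<le> 2" and cO: "card originals = card (pverts G) - 1"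
        using eq cS one lt \<alpha> by (auto simp: N_def)
      obtain u where u: "(v, u) \<in> parcs G"
        using has_neighbour v copies_subset by blast
      have sub: "originals \<subseteq> pverts G - {u}"
        using root_copy_original_two_apart(1)[OF assms(1) v] u originals_subset by blast
      have "originals = pverts G - {u}"
        using sub cO in_arcsD2[OF u] pair_finite_verts by (intro card_subset_eq) auto
      then have other: "w \<in> originals" if "w \<in> pverts G" "w \<noteq> u" for w
        using that by blast
      have leaf: "w = u" if "(v, w) \<in> parcs G" for w
        using root_copy_original_two_apart(1)[OF assms(1) v] other in_arcsD2[OF that] that by blast
      have "(w, u) \<in> parcs G" if "w \<in> pverts G" "w \<noteq> u" for w
        using root_copy_original_two_apart(2)[OF assms(1) v other[OF that]] leaf arc_sym by blast
      then show ?thesis using clique_with_leafI[OF \<alpha>2 u leaf] by blast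
    qed
    then show ?thesis using lt cS one \<alpha> by (auto simp: N_def)
  qed
qed

text \<open>
  The doubled vertices form the independent set of the structure, and the unused vertex is \<open>x\<close>.
  As the doubled vertices are a maximum independent set, every remaining vertex has a doubled
  neighbour, and it occurs as a copy only.  The matching expresses that no original lies between
  two copies and no copy between two originals; the adjacencies to \<open>x\<close> are forced by the triples
  in which an original and a copy would be at distance 3.
\<close>

lemma matched_structure_of_doubled:
  assumes unused: "pverts G - (originals \<union> copies) = {x}"
    and max: "card (originals \<inter> copies) = independence_number G"
    and \<alpha>: "independence_number G \<ge> 2"
  defines "C \<equiv> originals \<inter> copies"
  defines "V11 \<equiv> {u \<in> C. \<forall>v. (u, v) \<in> parcs G \<longrightarrow> v = x}"
  shows "matched_structure G V11 (C - V11) (pverts G - C - {x}) x"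
proof -
  define V2 where "V2 = pverts G - C - {x}"
  have finC: "finite C" using finite_originals by (simp add: C_def)
  have large: "\<not> card C \<le> Suc 0" using max \<alpha> by (simp add: C_def)
  have CV: "C \<subseteq> pverts G" using originals_subset by (auto simp: C_def)
  have xV: "x \<in> pverts G" "x \<notin> originals" "x \<notin> copies" using unused by auto
  then have xC: "x \<notin> C" by (simp add: C_def)
  have Cind: "(u, w) \<notin> parcs G" if "u \<in> C" "w \<in> C" for u w
    using that doubled_not_adjacent_to_original by (auto simp: C_def)
  have maximal: "z \<in> C" if "z \<in> pverts G" "\<And>w. w \<in> C \<Longrightarrow> (z, w) \<notin> parcs G" for z
  proof (rule ccontr)
    assume "z \<notin> C"
    have "independent_set G (insert z C)"
      unfolding independent_set_pair_iff using that CV Cind arc_sym by blast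
    then show False
      using card_independent_le max \<open>z \<notin> C\<close> finC by (fastforce simp: C_def)
  qed
  have "originals \<subseteq> C"
    using maximal originals_subset doubled_not_adjacent_to_original by (auto simp: C_def)
  then have V2copies: "v \<in> copies" if "v \<in> V2" for v
    using that unused by (auto simp: V2_def)
  have V2I: "v \<in> V2" if "(u, v) \<in> parcs G" "u \<in> C" "v \<noteq> x" for u v
    using that Cind in_arcsD2 by (auto simp: V2_def)
  have Cx: "(u, x) \<in> parcs G" if u: "u \<in> C" for u
  proof -
    obtain v where v: "(u, v) \<in> parcs G" using has_neighbour u CV by blast
    show ?thesis
    proof (cases "v = x")
      case False
      then have "v \<in> copies" using V2I V2copies u v by blast
      moreover obtain w where "w \<in> C" "w \<noteq> u"
        using large u card_le_Suc0_iff_eq[OF finC] by metis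
      \<comment> \<open>The shared neighbour is unused, and \<open>x\<close> is the only unused vertex.\<close>
      ultimately obtain y where "(u, y) \<in> parcs G" "y \<notin> originals \<union> copies"
        using doubled_share_unused_neighbour[of u w v] u v by (auto simp: C_def)
      then have "y \<in> {x}" unfolding unused[symmetric] using in_arcsD2 by blast
      then show ?thesis using \<open>(u, y) \<in> parcs G\<close> by simp
    qed (use v in simp)
  qed
  have C_match: "v = w" if "u \<in> C" "v \<in> V2" "w \<in> V2" "(u, v) \<in> parcs G" "(u, w) \<in> parcs G"
    for u v w
    using that copies_at_common_neighbour V2copies by (auto simp: C_def)
  have V2_match: "u = w" if "u \<in> C" "w \<in> C" "v \<in> V2" "(v, u) \<in> parcs G" "(v, w) \<in> parcs G"
    for u v w
    using that originals_at_common_copy[of u w v] V2copies Cind arc_sym by (auto simp: C_def)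
  have V2_partner: "\<exists>u. u \<in> C \<and> (v, u) \<in> parcs G" if "v \<in> V2" for v
    using that maximal by (auto simp: V2_def)
  have "\<exists>!b. b \<in> V2 \<and> (a, b) \<in> parcs G" if a: "a \<in> C - V11" for a
  proof -
    obtain b where "(a, b) \<in> parcs G" "b \<noteq> x" using a by (auto simp: V11_def)
    then show ?thesis using a V2I C_match by blast
  qed
  moreover have "\<exists>!a. a \<in> C - V11 \<and> (b, a) \<in> parcs G" if b: "b \<in> V2" for b
  proof -
    obtain a where a: "a \<in> C" "(b, a) \<in> parcs G" using V2_partner b by blast
    then have "a \<in> C - V11" using arc_sym[OF a(2)] b by (auto simp: V11_def V2_def)
    then show ?thesis using a b V2_match by blast
  qed
  ultimately have "perfect_matching_between G (C - V11) V2"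
    by (simp add: perfect_matching_between_def)
  moreover have "(x, z) \<in> parcs G" if u: "u \<in> V11" and z: "z \<in> pverts G" "z \<noteq> x" for u z
  proof (cases "z \<in> C")
    case True
    then show ?thesis using Cx arc_sym by blast
  next
    case False
    then have "z \<in> V2" using z by (simp add: V2_def)
    then obtain w where w: "w \<in> C" "(z, w) \<in> parcs G" using V2_partner by blast
    have uC: "u \<in> C" and leaf: "\<And>v. (v, u) \<in> parcs G \<Longrightarrow> v = x"
      using u arc_sym by (auto simp: V11_def)
    have "w \<noteq> u" using leaf w z by blast
    \<comment> \<open>Otherwise the copy of \<open>z\<close> is at distance 3 from \<open>u\<close>, with its partner \<open>w\<close> in between.\<close>
    have "(z, x) \<in> parcs G"
    proof (rule ccontr)
      assume "(z, x) \<notin> parcs G"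
      then have "(z, u) \<notin> parcs G" "(z, u) \<notin> parcs G O parcs G" using leaf z by blast+
      moreover have "(w, u) \<notin> parcs G" "(w, u) \<in> parcs G O parcs G"
        using Cind Cx arc_sym w uC by blast+
      ultimately show False
        using no_collinear_triple[OF gp, of "Copy z" "Orig w" "Orig u"] w uC \<open>w \<noteq> u\<close>
          V2copies[OF \<open>z \<in> V2\<close>]
        by (auto simp: C_def in_originals in_copies)
    qed
    then show ?thesis by (rule arc_sym)
  qed
  moreover have "(z, x) \<in> parcs G"
    if z: "z \<in> V2" "\<not> universal_vertex ((with_proj G) \<restriction> V2) z" for z
  proof -
    obtain y where y: "y \<in> V2" "y \<noteq> z" "(z, y) \<notin> parcs G"
      using z by (auto simp: universal_vertex_def arcs_ends_induce_subgraph)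
    \<comment> \<open>The partner of \<open>y\<close> must reach the copy of \<open>z\<close> in two steps, but not via \<open>y\<close>.\<close>
    obtain w where w: "w \<in> C" "(y, w) \<in> parcs G" using V2_partner y by blast
    then obtain m where m: "(w, m) \<in> parcs G" "(m, z) \<in> parcs G"
      using copies_within_two[of w y z] y z V2copies arc_sym by (auto simp: C_def)
    have "m = x"
    proof (rule ccontr)
      assume "m \<noteq> x"
      then have "m = y" using C_match[of w m y] V2I w m y arc_sym by blast
      then show False using m y arc_sym by blast
    qed
    then show ?thesis using m arc_sym by blast
  qed
  moreover have "independent_set G C"
    using independent_doubled by (simp add: C_def)
  moreover have "V11 \<subseteq> C" by (auto simp: V11_def)
  moreover have "(u, v) \<notin> parcs G" if "u \<in> V11" "v \<in> V2" for u v
    using that by (auto simp: V11_def V2_def)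
  ultimately show ?thesis
    unfolding matched_structure_def V2_def[symmetric]
    using CV xV xC Cx arc_sym
    by (auto simp: universal_vertex_def Un_absorb1 V2_def)
qed

text \<open>
  With two or more doubled vertices some vertex is unused, which gives the bound \<open>n - 1 + \<alpha>\<close>.
  With at most one the bound is \<open>n + 1\<close>, so equality forces \<open>\<alpha> = 2\<close>.
\<close>

lemma rootless_case:
  assumes "Root \<notin> S" and \<alpha>: "independence_number G \<ge> 2"
  defines "N \<equiv> card (pverts G) + independence_number G - 1"
  shows "card S \<le> N \<and> (card S = N \<longrightarrow>
    clique_with_leaf G \<or> (\<exists>V11 V12 V2 x. matched_structure G V11 V12 V2 x))"
proof -
  let ?U = "originals \<union> copies" and ?C = "originals \<inter> copies"
  have cS: "card S = card ?U + card ?C"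
    using card_eq_union_plus_doubled assms(1) .
  have sub: "?U \<subseteq> pverts G" using originals_subset copies_subset by blast
  then have Ule: "card ?U \<le> card (pverts G)" using pair_finite_verts by (simp add: card_mono)
  show ?thesis
  proof (cases "card ?C \<ge> 2")
    case True
    then have "?U \<subset> pverts G" using two_doubled_imp_unused_vertex sub by blast
    then have lt: "card ?U < card (pverts G)"
      using pair_finite_verts by (simp add: psubset_card_mono)
    have "\<exists>V11 V12 V2 x. matched_structure G V11 V12 V2 x" if "card S = N"
    proof -
      have "card ?C = independence_number G" "card ?U = card (pverts G) - 1"
        using that cS lt card_doubled_le by (auto simp: N_def)
      moreover have "card (pverts G - ?U) = card (pverts G) - card ?U"
        using sub finite_originals finite_copies by (intro card_Diff_subset) auto
      ultimately have "card (pverts G - ?U) = 1" "card ?C = independence_number G"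
        using lt by auto
      then show ?thesis
        using matched_structure_of_doubled \<alpha> by (metis card_1_singletonE)
    qed
    then show ?thesis using cS lt card_doubled_le by (auto simp: N_def)
  next
    case False
    have "clique_with_leaf G" if "card S = N"
    proof -
      have "independence_number G \<le> 2" "card ?C = 1" "card ?U = card (pverts G)"
        using that cS False Ule \<alpha> by (auto simp: N_def)
      moreover from this have "?U = pverts G"
        using sub pair_finite_verts by (intro card_subset_eq) auto
      ultimately show ?thesis
        using leaf_with_copy_everywhere by (metis card_1_singletonE)
    qed
    then show ?thesis using cS False Ule \<alpha> by (auto simp: N_def)
  qed
qed

end

section \<open>Sets that attain the bound\<close>

context isolate_free_graph
begin

text \<open>
  All copies together with the leaf itself are in general position: the copies are pairwise at
  distance 2, and the leaf is at distance 1 from only one of them and at distance 2 from the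
  others.
\<close>

lemma gp_set_of_clique_with_leaf:
  assumes "clique_with_leaf G" and n: "card (pverts G) \<ge> 3"
    and \<alpha>: "independence_number G \<ge> 2"
  shows "\<exists>S. general_position_set (mycielskian G) S \<and>
    card S = card (pverts G) + independence_number G - 1"
proof -
  obtain l where l: "l \<in> pverts G" "out_degree G l = 1"
      "K\<^bsub>card (pverts G) - 1\<^esub> ((with_proj G) \<restriction> (pverts G - {l}))"
    using assms(1) by (auto simp: clique_with_leaf_def)
  have clique: "(w, z) \<in> parcs G"
    if "w \<in> pverts G" "z \<in> pverts G" "w \<noteq> l" "z \<noteq> l" "w \<noteq> z" for w z
  proof -
    have "(w, z) \<in> arcs_ends ((with_proj G) \<restriction> (pverts G - {l}))"
      using l(3) that by (auto simp: complete_digraph_def)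
    then show ?thesis by (simp add: arcs_ends_induce_subgraph)
  qed
  obtain u where u: "(l, u) \<in> parcs G" using has_neighbour l by blast
  have leaf: "w = u" if "(l, w) \<in> parcs G" for w
  proof -
    obtain e where "out_arcs G l = {e}"
      using l(2) by (auto simp: out_degree_def card_1_singleton_iff)
    moreover have "(l, u) \<in> out_arcs G l" "(l, w) \<in> out_arcs G l"
      using u that by auto
    ultimately show ?thesis by auto
  qed
  have lu: "l \<noteq> u" "u \<in> pverts G" using u no_loops' in_arcsD2 by auto
  have hub: "(u, w) \<in> parcs G" if "w \<in> pverts G" "w \<noteq> u" for w
    using clique[of u w] lu that u arc_sym by blast
  have near: "(l, w) \<in> parcs G \<or> (l, w) \<in> parcs G O parcs G" if "w \<in> pverts G" for w
    using that hub u by (cases "w = u") auto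
  have "card I \<le> 2" if I: "independent_set G I" for I
  proof -
    have fin: "finite I"
      using I pair_finite_verts finite_subset unfolding independent_set_pair_iff by blast
    have "a = b" if "a \<in> I - {l}" "b \<in> I - {l}" for a b
      using that I clique[of a b] unfolding independent_set_pair_iff by blast
    then have "card (I - {l}) \<le> Suc 0"
      using card_le_Suc0_iff_eq[of "I - {l}"] fin by auto
    then show ?thesis using card_Diff_singleton_if[of I l] by (auto split: if_splits)
  qed
  then have \<alpha>2: "independence_number G = 2"
    using independence_number_attained[of "with_proj G"] pair_finite_verts \<alpha>
    by (metis le_antisym with_proj_simps(1))
  let ?S = "insert (Orig l) (Copy ` pverts G)"
  have "mycielski_dist G a c \<noteq> mycielski_dist G a b + mycielski_dist G b c"
    if abc: "a \<in> ?S" "b \<in> ?S" "c \<in> ?S" "distinct [a, b, c]" for a b c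
  proof -
    have dist_l: "mycielski_dist G (Orig l) (Copy v) = (if v = u then 1 else 2)"
        "mycielski_dist G (Copy v) (Orig l) = (if v = u then 1 else 2)" if "v \<in> pverts G" for v
    proof -
      have "(l, v) \<in> parcs G \<longleftrightarrow> v = u" "(v, l) \<in> parcs G \<longleftrightarrow> v = u"
        "v \<noteq> u \<Longrightarrow> (l, v) \<in> parcs G O parcs G" "v \<noteq> u \<Longrightarrow> (v, l) \<in> parcs G O parcs G"
        using near[OF that] u leaf arc_sym by blast+
      then show "mycielski_dist G (Orig l) (Copy v) = (if v = u then 1 else 2)"
          "mycielski_dist G (Copy v) (Orig l) = (if v = u then 1 else 2)"
        by simp_all
    qed
    show ?thesis
      using abc by (cases a; cases b; cases c) (auto simp del: mycielski_dist.simps(2,3) simp: dist_l split: if_splits)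
  qed
  then have "general_position_set (mycielskian G) ?S"
    using l(1) unfolding general_position_set_mycielskian_iff by auto
  moreover have "card ?S = card (pverts G) + 1"
    using pair_finite_verts by (subst card_insert_disjoint) (auto simp: card_image inj_on_def)
  ultimately show ?thesis using \<alpha>2 by auto
qed

text \<open>
  Originals are taken from the independent set and copies from all vertices but \<open>x\<close>.  Two
  originals, and likewise two copies, are at distance 2.  So a collinear triple needs either
  two adjacent pairs in it, which contradicts the matching, or an original and a copy at
  distance 3, one of which is adjacent to the third vertex; the conditions on \<open>x\<close> provide a walk of
  length 2 in that case.
\<close>

lemma gp_set_of_matched_structure:
  assumes str: "matched_structure G V11 V12 V2 x"
  shows "general_position_set (mycielskian G)
    (Orig ` (V11 \<union> V12) \<union> Copy ` (pverts G - {x}))"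
    (is "general_position_set _ ?S")
proof -
  let ?E = "parcs G" and ?C = "V11 \<union> V12"
  have V: "pverts G = V11 \<union> V12 \<union> V2 \<union> {x}"
    and C_indep: "independent_set G ?C"
    and xC: "\<And>u. u \<in> ?C \<Longrightarrow> (x, u) \<in> ?E"
    and x_univ: "V11 \<noteq> {} \<Longrightarrow> universal_vertex G x"
    and match1: "\<And>a. a \<in> V12 \<Longrightarrow> \<exists>!b. b \<in> V2 \<and> (a, b) \<in> ?E"
    and match2: "\<And>b. b \<in> V2 \<Longrightarrow> \<exists>!a. a \<in> V12 \<and> (b, a) \<in> ?E"
    and V11V2: "\<And>u v. u \<in> V11 \<Longrightarrow> v \<in> V2 \<Longrightarrow> (u, v) \<notin> ?E"
    using str unfolding matched_structure_def perfect_matching_between_def by auto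
  have Cind: "(u, w) \<notin> ?E" if "u \<in> ?C" "w \<in> ?C" for u w
    using C_indep that no_loops' unfolding independent_set_pair_iff by blast
  have xall: "(x, z) \<in> ?E" if "V11 \<noteq> {}" "z \<in> pverts G" "z \<noteq> x" for z
    using x_univ that by (simp add: universal_vertex_def)
  have nonuniv: "(x, v) \<in> ?E" if "v \<in> V2" "z \<in> V2" "z \<noteq> v" "(v, z) \<notin> ?E" for v z
  proof -
    have "\<not> universal_vertex ((with_proj G) \<restriction> V2) v"
      using that by (auto simp: universal_vertex_def arcs_ends_induce_subgraph)
    then show ?thesis using str that arc_sym by (auto simp: matched_structure_def)
  qed
  have C_two: "(u, w) \<in> ?E O ?E" if "u \<in> ?C" "w \<in> ?C" for u w
    using xC that arc_sym by blast
  have out_C: "v \<in> V2 \<and> u \<in> V12" if "u \<in> ?C" "v \<in> pverts G - {x}" "(u, v) \<in> ?E" for u v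
    using that V Cind V11V2 by blast
  have one_copy: "v = w" if "u \<in> ?C" "v \<in> pverts G - {x}" "w \<in> pverts G - {x}"
      "(u, v) \<in> ?E" "(u, w) \<in> ?E" for u v w
    using out_C that match1 by blast
  have one_original: "u = w" if "u \<in> ?C" "w \<in> ?C" "v \<in> pverts G - {x}"
      "(u, v) \<in> ?E" "(w, v) \<in> ?E" for u v w
    using out_C[of u v] out_C[of w v] that match2 arc_sym by blast
  have copies_near: "(u, w) \<in> ?E \<or> (u, w) \<in> ?E O ?E"
    if u: "u \<in> ?C" "v \<in> pverts G - {x}" "(u, v) \<in> ?E" and w: "w \<in> pverts G - {x}" for u v w
  proof (cases "w \<in> ?C")
    case True
    then show ?thesis using C_two u by blast
  next
    case False
    then have wV: "w \<in> V2" using w V by blast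
    have vV: "v \<in> V2" using out_C u by blast
    consider "w = v" | "(v, w) \<in> ?E" | "w \<noteq> v" "(v, w) \<notin> ?E" by blast
    then show ?thesis
    proof cases
      case 3
      then have "(x, w) \<in> ?E" using nonuniv[OF wV vV] arc_sym by blast
      then show ?thesis using xC u arc_sym by blast
    qed (use u in blast)+
  qed
  have originals_near: "(w, v) \<in> ?E \<or> (w, v) \<in> ?E O ?E"
    if u: "u \<in> ?C" "v \<in> pverts G - {x}" "(u, v) \<in> ?E" and w: "w \<in> ?C" for u v w
  proof (cases "w \<in> V11")
    case True
    then have "(x, v) \<in> ?E" using xall u by blast
    then show ?thesis using xC w arc_sym by blast
  next
    case False
    then obtain z where z: "z \<in> V2" "(w, z) \<in> ?E" using match1 w by blast
    have vV: "v \<in> V2" using out_C u by blast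
    consider "z = v" | "(z, v) \<in> ?E" | "z \<noteq> v" "(z, v) \<notin> ?E" by blast
    then show ?thesis
    proof cases
      case 3
      then have "(x, v) \<in> ?E" using nonuniv[OF vV z(1)] arc_sym by blast
      then show ?thesis using xC w arc_sym by blast
    qed (use z in blast)+
  qed
  have OO: "mycielski_dist G (Orig u) (Orig w) = 2" if "u \<in> ?C" "w \<in> ?C" "u \<noteq> w" for u w
    using that Cind C_two by auto
  have OC_sym: "mycielski_dist G (Copy v) (Orig u) = mycielski_dist G (Orig u) (Copy v)" for u v
  proof -
    have "(v, u) \<in> ?E \<longleftrightarrow> (u, v) \<in> ?E" "(v, u) \<in> ?E O ?E \<longleftrightarrow> (u, v) \<in> ?E O ?E"
      using arc_sym by blast+
    then show ?thesis by simp
  qed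
  have OC: "mycielski_dist G (Orig u) (Copy v) = 1 \<longleftrightarrow> (u, v) \<in> ?E"
      "mycielski_dist G (Orig u) (Copy v) \<ge> 1"
      "mycielski_dist G (Orig u) (Copy v) \<le> 3"
      "mycielski_dist G (Orig u) (Copy v) \<le> 2 \<longleftrightarrow> (u, v) \<in> ?E \<or> (u, v) \<in> ?E O ?E" for u v
    by auto
  have "mycielski_dist G a c \<noteq> mycielski_dist G a b + mycielski_dist G b c"
    if abc: "a \<in> ?S" "b \<in> ?S" "c \<in> ?S" "distinct [a, b, c]" for a b c
  proof
    assume col: "mycielski_dist G a c = mycielski_dist G a b + mycielski_dist G b c"
    have OOC: False if "u \<in> ?C" "w \<in> ?C" "v \<in> pverts G - {x}" "u \<noteq> w"
        "mycielski_dist G (Orig u) (Copy v) = 2 + mycielski_dist G (Orig w) (Copy v)" for u w v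
      using OC[of u v] OC[of w v] originals_near[of w v u] that by linarith
    have OCC: False if "u \<in> ?C" "v \<in> pverts G - {x}" "w \<in> pverts G - {x}"
        "mycielski_dist G (Orig u) (Copy w) = mycielski_dist G (Orig u) (Copy v) + 2" for u w v
      using OC[of u v] OC[of u w] copies_near[of u v w] that by linarith
    have OCO: False if "u \<in> ?C" "v \<in> pverts G - {x}" "w \<in> ?C" "u \<noteq> w"
        "2 = mycielski_dist G (Orig u) (Copy v) + mycielski_dist G (Orig w) (Copy v)" for u w v
      using OC[of u v] OC[of w v] one_original[of u w v] that by linarith
    have COC: False if "u \<in> ?C" "v \<in> pverts G - {x}" "w \<in> pverts G - {x}" "v \<noteq> w"
        "2 = mycielski_dist G (Orig u) (Copy v) + mycielski_dist G (Orig u) (Copy w)" for u w v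
      using OC[of u v] OC[of u w] one_copy[of u v w] that by linarith
    have S_cases: "\<exists>u. z = Orig u \<and> u \<in> ?C \<or> z = Copy u \<and> u \<in> pverts G - {x}" if "z \<in> ?S" for z
      using that by blast
    obtain i where i: "a = Orig i \<and> i \<in> ?C \<or> a = Copy i \<and> i \<in> pverts G - {x}"
      using S_cases[OF abc(1)] ..
    obtain j where j: "b = Orig j \<and> j \<in> ?C \<or> b = Copy j \<and> j \<in> pverts G - {x}"
      using S_cases[OF abc(2)] ..
    obtain k where k: "c = Orig k \<and> k \<in> ?C \<or> c = Copy k \<and> k \<in> pverts G - {x}"
      using S_cases[OF abc(3)] ..
    have CC: "mycielski_dist G (Copy v) (Copy w) = 2" if "v \<noteq> w" for v w
      using that by simp
    show False
      using i j k col abc(4) OOC[of i j k] OOC[of k j i] OCC[of i j k] OCC[of k j i]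
        OCO[of i j k] COC[of j i k]
      by (elim disjE conjE)
        (simp_all add: OO CC OC_sym add.commute del: mycielski_dist.simps Un_iff)
  qed
  then show ?thesis
    using V unfolding general_position_set_mycielskian_iff by auto
qed

lemma perfect_matching_partners:
  assumes "perfect_matching_between G A B"
  obtains f where "\<And>b. b \<in> B \<Longrightarrow> f b \<in> A \<and> (b, f b) \<in> parcs G" "inj_on f B"
proof -
  have "\<forall>b \<in> B. \<exists>a. a \<in> A \<and> (b, a) \<in> parcs G"
    and unique: "\<And>a. a \<in> A \<Longrightarrow> \<exists>!b. b \<in> B \<and> (a, b) \<in> parcs G"
    using assms by (auto simp: perfect_matching_between_def)
  then obtain f where f: "\<And>b. b \<in> B \<Longrightarrow> f b \<in> A \<and> (b, f b) \<in> parcs G"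
    by (metis (no_types))
  then have "inj_on f B"
    using unique arc_sym by (metis inj_onI)
  then show ?thesis using f that by blast
qed

text \<open>
  An independent set avoiding \<open>x\<close> is mapped injectively into \<open>V11 \<union> V12\<close> by replacing each
  vertex of \<open>V2\<close> by its partner.  One that contains \<open>x\<close> otherwise consists of vertices of \<open>V2\<close>
  not adjacent to \<open>x\<close>; these are universal in \<open>V2\<close>, so there is at most one of them.
\<close>

lemma card_independent_set_matched_structure:
  assumes str: "matched_structure G V11 V12 V2 x" and I: "independent_set G I"
  shows "card I \<le> max 2 (card (V11 \<union> V12))"
proof -
  have V: "pverts G = V11 \<union> V12 \<union> V2 \<union> {x}"
    and xC: "\<And>u. u \<in> V11 \<union> V12 \<Longrightarrow> (x, u) \<in> parcs G"
    and matching: "perfect_matching_between G V12 V2"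
    using str unfolding matched_structure_def by auto
  have fin: "finite (V11 \<union> V12)" using V pair_finite_verts by simp
  have IV: "I \<subseteq> pverts G" and Iind: "\<And>u v. u \<in> I \<Longrightarrow> v \<in> I \<Longrightarrow> u \<noteq> v \<Longrightarrow> (u, v) \<notin> parcs G"
    using I unfolding independent_set_pair_iff by blast+
  have finI: "finite I" using IV pair_finite_verts finite_subset by blast
  show ?thesis
  proof (cases "x \<in> I")
    case True
    have "v = w" if v: "v \<in> I - {x}" and w: "w \<in> I - {x}" for v w
    proof (rule ccontr)
      assume "v \<noteq> w"
      have "v \<in> V2" "w \<in> V2"
        using v w Iind[of x] True xC IV V by blast+
      moreover have "(v, w) \<notin> parcs G" using Iind v w \<open>v \<noteq> w\<close> by blast
      ultimately have "\<not> universal_vertex ((with_proj G) \<restriction> V2) v"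
        using \<open>v \<noteq> w\<close> by (auto simp: universal_vertex_def arcs_ends_induce_subgraph)
      then have "(v, x) \<in> parcs G"
        using str \<open>v \<in> V2\<close> by (auto simp: matched_structure_def)
      then show False using Iind True v by blast
    qed
    then have "card (I - {x}) \<le> Suc 0"
      using card_le_Suc0_iff_eq[of "I - {x}"] finI by auto
    then show ?thesis using True card_Diff_singleton[of x I] by simp
  next
    case False
    obtain partner where partner: "\<And>v. v \<in> V2 \<Longrightarrow> partner v \<in> V12 \<and> (v, partner v) \<in> parcs G"
        "inj_on partner V2"
      using perfect_matching_partners[OF matching] by blast
    define f where "f v = (if v \<in> V2 then partner v else v)" for v
    have "inj_on f I"
    proof (rule inj_onI)
      fix v w assume vw: "v \<in> I" "w \<in> I" "f v = f w"
      consider "v \<in> V2" "w \<in> V2" | "v \<in> V2" "w \<notin> V2" | "v \<notin> V2" "w \<in> V2" | "v \<notin> V2" "w \<notin> V2"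
        by blast
      then show "v = w"
      proof cases
        case 1
        then have "partner v = partner w" using vw by (simp add: f_def)
        then show ?thesis using partner(2) 1 by (simp add: inj_on_def)
      next
        case 2
        then have "(v, w) \<in> parcs G" using partner(1)[of v] vw(3) by (simp add: f_def)
        then show ?thesis using Iind vw by blast
      next
        case 3
        then have "(w, v) \<in> parcs G" using partner(1)[of w] vw(3)[symmetric] by (simp add: f_def)
        then show ?thesis using Iind vw by blast
      next
        case 4
        then show ?thesis using vw by (simp add: f_def)
      qed
    qed
    moreover have "f ` I \<subseteq> V11 \<union> V12"
      using partner(1) IV V False by (auto simp: f_def)
    ultimately have "card I \<le> card (V11 \<union> V12)" using card_inj_on_le fin by blast
    then show ?thesis by simp
  qed
qed

text \<open>
  If \<open>V11 \<union> V12\<close> has at least two elements, it is a maximum independent set and the set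
  of the lemma above has the right size.  Otherwise \<open>G\<close> has only three vertices, and because \<open>\<alpha>\<close>
  is at least 2 it is a path: then \<open>V11 \<union> V12\<close> is too small, but a path on three vertices is
  also a clique with a leaf.
\<close>

lemma matched_structure_attains:
  assumes str: "matched_structure G V11 V12 V2 x"
    and n: "card (pverts G) \<ge> 3" and \<alpha>: "independence_number G \<ge> 2"
  shows "\<exists>S. general_position_set (mycielskian G) S \<and>
    card S = card (pverts G) + independence_number G - 1"
proof -
  let ?C = "V11 \<union> V12"
  have V: "pverts G = ?C \<union> V2 \<union> {x}" and disj: "?C \<inter> V2 = {}" "x \<notin> ?C \<union> V2"
    and Cind: "independent_set G ?C"
    and xC: "\<And>u. u \<in> ?C \<Longrightarrow> (x, u) \<in> parcs G"
    and matching: "perfect_matching_between G V12 V2"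
    using str unfolding matched_structure_def by auto
  have fin: "finite ?C" "finite V2" using V pair_finite_verts by simp_all
  have \<alpha>_le: "independence_number G \<le> max 2 (card ?C)"
    using independence_number_attained[of "with_proj G"] pair_finite_verts
      card_independent_set_matched_structure[OF str]
    by (metis with_proj_simps(1))
  show ?thesis
  proof (cases "card ?C \<ge> 2")
    case True
    then have \<alpha>C: "independence_number G = card ?C"
      using \<alpha>_le card_independent_le[OF Cind] by simp
    let ?S = "Orig ` ?C \<union> Copy ` (pverts G - {x})"
    have "card ?S = card (Orig ` ?C) + card (Copy ` (pverts G - {x}))"
      using fin pair_finite_verts by (intro card_Un_disjoint) auto
    also have "\<dots> = card ?C + card (pverts G - {x})"
      by (simp add: card_image inj_on_def)
    also have "card (pverts G - {x}) = card (pverts G) - 1"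
      using V by (intro card_Diff_singleton) blast
    finally have "card ?S = card (pverts G) + independence_number G - 1"
      using n \<alpha>C by simp
    then show ?thesis using gp_set_of_matched_structure[OF str] by blast
  next
    case False
    have "card (pverts G) = card ?C + card V2 + 1"
      using V disj fin by (simp add: card_Un_disjoint)
    moreover have "card V2 \<le> card ?C"
    proof -
      obtain partner where "\<And>v. v \<in> V2 \<Longrightarrow> partner v \<in> V12 \<and> (v, partner v) \<in> parcs G"
          "inj_on partner V2"
        using perfect_matching_partners[OF matching] by blast
      moreover from this have "partner ` V2 \<subseteq> ?C" by blast
      ultimately show ?thesis using card_inj_on_le fin by blast
    qed
    ultimately have "card ?C = 1" "card V2 = 1" using n False by auto
    then obtain u v where uv: "?C = {u}" "V2 = {v}" by (auto simp: card_1_singleton_iff)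
    obtain a where a: "a \<in> V12" "(v, a) \<in> parcs G"
      using perfect_matching_partners[OF matching] uv(2) by blast
    then have "a \<in> ?C" by blast
    then have "a = u" by (simp only: uv(1) singleton_iff)
    then have arcs: "(v, u) \<in> parcs G" "(x, u) \<in> parcs G"
      using a(2) xC[OF \<open>a \<in> ?C\<close>] by simp_all
    have "(v, x) \<notin> parcs G"
    proof
      assume vx: "(v, x) \<in> parcs G"
      obtain I where I: "independent_set G I" "card I = independence_number G"
        using independence_number_attained[of "with_proj G"] pair_finite_verts by auto
      then have "\<not> card I \<le> Suc 0" using \<alpha> by simp
      then obtain a b where ab: "a \<in> I" "b \<in> I" "a \<noteq> b"
        using card_le_Suc0_iff_eq[of I] card.infinite by fastforce
      then have "(a, b) \<notin> parcs G" "a \<in> {u, v, x}" "b \<in> {u, v, x}"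
        using I V uv unfolding independent_set_pair_iff by blast+
      then show False using ab arcs vx arc_sym by blast
    qed
    then have "w = u" if "(v, w) \<in> parcs G" for w
      using that in_arcsD2[OF that] V uv no_loops' by auto
    moreover have "(w, u) \<in> parcs G" if "w \<in> pverts G" "w \<noteq> u" for w
      using that V uv arcs by auto
    moreover have "independence_number G \<le> 2" using \<alpha>_le False by simp
    ultimately have "clique_with_leaf G" using clique_with_leafI arcs(1) by blast
    then show ?thesis using gp_set_of_clique_with_leaf n \<alpha> by blast
  qed
qed

end

theorem corollary20:
  fixes G :: "'a pair_pre_digraph" and n :: nat
  assumes "pair_graph G"
    and "connected G"
    and "card (pverts G) = n"
    and "n \<ge> 3"
    and "\<not> K\<^bsub>n\<^esub> G"
  shows "gp_number (mycielskian G) = n + independence_number G - 1 \<longleftrightarrow>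
    clique_with_leaf G \<or> (\<exists>V11 V12 V2 x. matched_structure G V11 V12 V2 x)"
proof -
  interpret pair_graph G by fact
  have "\<exists>v. (u, v) \<in> parcs G" if u: "u \<in> pverts G" for u
  proof -
    have "strongly_connected G"
      using symmetric_connected_imp_strongly_connected sym_arcs assms(2) by simp
    moreover obtain w where w: "w \<in> pverts G" "w \<noteq> u"
    proof -
      have "\<not> card (pverts G) \<le> Suc 0" using assms(3,4) by simp
      then show ?thesis using that u card_le_Suc0_iff_eq[OF pair_finite_verts] by metis
    qed
    ultimately have "u \<rightarrow>\<^sup>*\<^bsub>G\<^esub> w"
      using u by (auto simp: strongly_connected_def)
    then show ?thesis
      using w by (cases rule: converse_reachable_cases) auto
  qed
  then interpret isolate_free_graph G
    by unfold_locales
  obtain p q where pq: "p \<in> pverts G" "q \<in> pverts G" "p \<noteq> q" "(p, q) \<notin> parcs G"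
  proof -
    have "parcs G \<noteq> {(u, v). (u, v) \<in> pverts G \<times> pverts G \<and> u \<noteq> v}"
      using assms(3,5) pair_finite_verts unfolding complete_digraph_pair_def by blast
    moreover have "parcs G \<subseteq> {(u, v). (u, v) \<in> pverts G \<times> pverts G \<and> u \<noteq> v}"
      by (auto dest: in_arcsD1 in_arcsD2 no_loops')
    ultimately show ?thesis using that by auto
  qed
  have "independent_set G {p, q}"
    using pq arc_sym unfolding independent_set_pair_iff by blast
  then have \<alpha>: "independence_number G \<ge> 2"
    using card_independent_le[of "{p, q}"] pq(3) by simp
  let ?N = "card (pverts G) + independence_number G - 1"
  let ?struct = "clique_with_leaf G \<or> (\<exists>V11 V12 V2 x. matched_structure G V11 V12 V2 x)"
  have gp: "card S \<le> ?N \<and> (card S = ?N \<longrightarrow> ?struct)"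
    if "general_position_set (mycielskian G) S" for S
  proof -
    interpret mycielskian_gp_set G S
      using that by unfold_locales
    show ?thesis
      using root_case[OF _ \<alpha> pq] rootless_case[OF _ \<alpha>] by blast
  qed
  have "finite (verts (mycielskian G))"
    using pair_graph_mycielskian[OF assms(1)] pair_fin_digraph.pair_finite_verts
    by (simp add: mycielskian_def pair_finite_verts)
  then have "gp_number (mycielskian G) = ?N \<longleftrightarrow>
      (\<exists>S. general_position_set (mycielskian G) S \<and> card S = ?N)"
    using gp_number_eq_iff_attained gp by blast
  also have "\<dots> \<longleftrightarrow> ?struct"
    using gp gp_set_of_clique_with_leaf matched_structure_attains \<alpha> assms(3,4) by blast
  finally show ?thesis using assms(3) by simp
qed

end
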